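(* Let $n\ge 1$ and let $B_i^n(x)=\binom{n}{i}x^i(1-x)^{n-i}$, $0\le i\le n$, be the Bernstein basis of the space of polynomials of degree at most $n$. The differentiation matrix $\mathbf{D}_B$ in this basis is tridiagonal, with entries (row and column indices $i,j$ running from $0$ to $n$) $$[\mathbf{D}_B]_{i,j}=\begin{cases}2i-n, & i=j,\\ -i, & j=i-1,\\ n-i, & j=i+1,\end{cases}$$ and all other entries equal to zero.
   Context: The differentiation matrix $\mathbf{D}_B$ is the $(n+1)\times(n+1)$ matrix such that if $p=\sum_{k=0}^n a_kB_k^n$ and $p'=\sum_{k=0}^n b_kB_k^n$ (the derivative being expressed in the same degree-$n$ Bernstein basis) then $\mathbf{b}=\mathbf{D}_B\mathbf{a}$, where $\mathbf{a}=[a_0,\ldots,a_n]^T$ and $\mathbf{b}=[b_0,\ldots,b_n]^T$. *)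

theory Defs
  imports "HOL-Computational_Algebra.Polynomial" "Jordan_Normal_Form.Matrix"
begin

text \<open>
  Bernstein polynomials as formal polynomials, over an arbitrary field of characteristic 0
  (covering real and complex coefficients). The constant \<open>Bernstein\<close> of HOL-Analysis is the
  evaluation function of this polynomial over the reals; see \<open>poly_bernstein_poly\<close>.
\<close>

definition bernstein_poly :: "nat \<Rightarrow> nat \<Rightarrow> 'a::field_char_0 poly" where
  "bernstein_poly n i = Polynomial.smult (of_nat (n choose i)) ([:0, 1:] ^ i * [:1, -1:] ^ (n - i))"

lemma poly_bernstein_poly:
  "poly (bernstein_poly n i) x = of_nat (n choose i) * x ^ i * (1 - x) ^ (n - i)"
  by (simp add: bernstein_poly_def)

definition bernstein_comb :: "nat \<Rightarrow> 'a::field_char_0 vec \<Rightarrow> 'a poly" where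
  "bernstein_comb n a = (\<Sum>k=0..n. Polynomial.smult (a $ k) (bernstein_poly n k))"

text \<open>
  No uniqueness of the coefficient vectors \<open>a\<close> and \<open>b\<close> and no existence of \<open>b\<close> is built into
  this definition: if some derivative had no expansion, or more than one, then the matrix
  would fail to be unique, or to exist.
\<close>

definition is_bernstein_diff_mat :: "nat \<Rightarrow> 'a::field_char_0 mat \<Rightarrow> bool" where
  "is_bernstein_diff_mat n D \<longleftrightarrow>
     D \<in> carrier_mat (n + 1) (n + 1) \<and>
     (\<forall>p. \<forall>a \<in> carrier_vec (n + 1). \<forall>b \<in> carrier_vec (n + 1).
        p = bernstein_comb n a \<longrightarrow> pderiv p = bernstein_comb n b \<longrightarrow> b = D *\<^sub>v a)"

end

theory Submission imports Defs begin

text \<open>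
  Multiplying the derivative of \<open>x\<^sup>k (1 - x)\<^bsup>n - k\<^esup>\<close> by \<open>x + (1 - x) = 1\<close>
  raises its degree back to \<open>n\<close>, which expresses the derivative of a Bernstein polynomial through
  its two neighbours and itself; these three coefficients form a column of the matrix.
  Uniqueness of the expansion holds because the \<open>k\<close>-th Bernstein polynomial vanishes to
  order exactly \<open>k\<close> at \<open>0\<close>.
\<close>

lemma smult_sum_right:
  "Polynomial.smult c (\<Sum>i\<in>S. p i) = (\<Sum>i\<in>S. Polynomial.smult c (p i))"
  by (induction S rule: infinite_finite_induct) (simp_all add: smult_add_right)

lemma pderiv_sum:
  "pderiv (\<Sum>i\<in>S. p i) = (\<Sum>i\<in>S. pderiv (p i))"
  by (induction S rule: infinite_finite_induct) (simp_all add: pderiv_add)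

lemma mult_mat_vec_unit_vec:
  fixes A :: "'a::semiring_1 mat"
  assumes "A \<in> carrier_mat m n" "j < n"
  shows "A *\<^sub>v unit_vec n j = col A j"
  using assms by (intro eq_vecI) simp_all

lemma bernstein_poly_eq_0: "n < i \<Longrightarrow> bernstein_poly n i = 0"
  by (simp add: bernstein_poly_def)

text \<open>The factor \<open>[:0, 1:] ^ j\<close> shifts coefficients up by \<open>j\<close>, and
  the cofactor has constant coefficient 1. This makes the system for the coefficients of a
  combination triangular.\<close>

lemma coeff_bernstein_poly:
  assumes "i \<le> j"
  shows "coeff (bernstein_poly n j) i = (if i = j then of_nat (n choose j) else 0)"
proof -
  have "bernstein_poly n j
      = monom (of_nat (n choose j) :: 'a) j * [:1, -1:] ^ (n - j)"
    by (simp add: bernstein_poly_def monom_altdef)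
  then show ?thesis
    using assms by (simp add: coeff_monom_mult coeff_0_power)
qed

lemma bernstein_comb_diff:
  assumes "a \<in> carrier_vec (n + 1)" "b \<in> carrier_vec (n + 1)"
  shows "bernstein_comb n (a - b) = bernstein_comb n a - bernstein_comb n b"
  using assms
  by (simp add: bernstein_comb_def smult_diff_left flip: sum_subtractf)

lemma bernstein_comb_eq_0:
  assumes "bernstein_comb n c = 0" "k \<le> n"
  shows "c $ k = 0"
  using \<open>k \<le> n\<close>
proof (induction k rule: less_induct)
  case (less k)
  \<comment> \<open>Terms with \<open>j < k\<close> vanish by the induction hypothesis, those with
    \<open>j > k\<close> by the order of vanishing at 0. The surviving binomial is nonzero in
    characteristic 0.\<close>
  have "c $ j * coeff (bernstein_poly n j) k
      = (if j = k then c $ k * of_nat (n choose k) else 0)" if "j \<le> n" for j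
    using less that by (cases j k rule: linorder_cases) (simp_all add: coeff_bernstein_poly)
  then have "coeff (bernstein_comb n c) k
      = (\<Sum>j=0..n. if j = k then c $ k * of_nat (n choose k) else 0)"
    unfolding bernstein_comb_def coeff_sum coeff_smult by (intro sum.cong) auto
  also have "\<dots> = c $ k * of_nat (n choose k)"
    using less.prems by simp
  finally show ?case
    using assms(1) less.prems by simp
qed

lemma bernstein_comb_inject:
  assumes "a \<in> carrier_vec (n + 1)" "b \<in> carrier_vec (n + 1)"
    and "bernstein_comb n a = bernstein_comb n b"
  shows "a = b"
proof (rule eq_vecI)
  fix i assume "i < dim_vec b"
  then have "(a - b) $ i = 0"
    using assms by (intro bernstein_comb_eq_0[of n]) (simp_all add: bernstein_comb_diff)
  then show "a $ i = b $ i"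
    using assms \<open>i < dim_vec b\<close> by simp
qed (use assms in simp)

text \<open>The left side is what differentiating the power of x in the Bernstein polynomial of
  index \<open>Suc i\<close> yields. Up to sign and a rewritten scalar, it is also what the power of
  1 - x contributes at index \<open>i\<close>, so one identity serves both halves of the product
  rule.\<close>

lemma bernstein_raise_left:
  assumes "Suc i \<le> n"
  shows "Polynomial.smult (of_nat (Suc i) * of_nat (n choose Suc i)) ([:0, 1:] ^ i * [:1, -1:] ^ (n - Suc i))
    = Polynomial.smult (of_nat (n - i)) (bernstein_poly n i)
      + Polynomial.smult (of_nat (Suc i)) (bernstein_poly n (Suc i) :: 'a::field_char_0 poly)"
proof -
  define x y :: "'a poly" where "x = [:0, 1:]" and "y = [:1, -1:]"
  have xy: "x + y = 1" by (simp add: x_def y_def)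
  have ni: "n - i = Suc (n - Suc i)" using assms by simp
  \<comment> \<open>Both sides equal \<open>n * ((n - 1) choose i)\<close>.\<close>
  have binom: "(n - i) * (n choose i) = Suc i * (n choose Suc i)"
    by (metis binomial_absorb_comp binomial_absorption)
  then have coeff: "of_nat (n - i) * of_nat (n choose i) = (of_nat (Suc i) * of_nat (n choose Suc i) :: 'a)"
    by (metis of_nat_mult)
  have "x ^ i * y ^ (n - Suc i) = (x + y) * (x ^ i * y ^ (n - Suc i))"
    by (simp add: xy)
  also have "\<dots> = x ^ i * y ^ (n - i) + x ^ Suc i * y ^ (n - Suc i)"
    by (simp add: ni algebra_simps)
  finally show ?thesis
    unfolding bernstein_poly_def x_def[symmetric] y_def[symmetric] smult_smult coeff
    by (simp only: smult_add_right)
qed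

text \<open>Product rule. The truncated exponents \<open>k - 1\<close> and \<open>m - 1\<close> are
  harmless at 0, where the scalar in front vanishes.\<close>

lemma pderiv_bernstein_monomial:
  "pderiv ([:0, 1:] ^ k * [:1, -1:] ^ m :: 'a::field_char_0 poly) =
     Polynomial.smult (of_nat k) ([:0, 1:] ^ (k - 1) * [:1, -1:] ^ m)
     - Polynomial.smult (of_nat m) ([:0, 1:] ^ k * [:1, -1:] ^ (m - 1))"
  by (simp add: pderiv_mult pderiv_power pderiv_pCons algebra_simps flip: of_nat_poly)

text \<open>The two halves of the product rule contribute \<open>k\<close> and
  \<open>-(n - k)\<close> to the middle coefficient. The guard at \<open>k = 0\<close> is essential,
  since \<open>k - 1\<close> would then be 0 and add a spurious multiple of the polynomial of index
  0; at \<open>k = n\<close> the last term is zero by itself.\<close>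

lemma pderiv_bernstein_poly:
  assumes "k \<le> n"
  shows "pderiv (bernstein_poly n k :: 'a::field_char_0 poly) =
    (if k = 0 then 0 else Polynomial.smult (of_nat (n - (k - 1))) (bernstein_poly n (k - 1)))
    + Polynomial.smult (2 * of_nat k - of_nat n) (bernstein_poly n k)
    - Polynomial.smult (of_nat (k + 1)) (bernstein_poly n (k + 1))"
proof -
  let ?x = "[:0, 1:] :: 'a poly" and ?y = "[:1, -1:] :: 'a poly"
  have left: "Polynomial.smult (of_nat k * of_nat (n choose k)) (?x ^ (k - 1) * ?y ^ (n - k))
      = (if k = 0 then 0 else Polynomial.smult (of_nat (n - (k - 1))) (bernstein_poly n (k - 1)))
        + Polynomial.smult (of_nat k) (bernstein_poly n k)"
  proof (cases k)
    case (Suc i)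
    then show ?thesis using bernstein_raise_left[of i n] assms by simp
  qed simp
  have binom: "of_nat (n - k) * of_nat (n choose k) = (of_nat (Suc k) * of_nat (n choose Suc k) :: 'a)"
    by (metis binomial_absorb_comp binomial_absorption of_nat_mult)
  have right: "Polynomial.smult (of_nat (n - k) * of_nat (n choose k)) (?x ^ k * ?y ^ (n - k - 1))
      = Polynomial.smult (of_nat (n - k)) (bernstein_poly n k)
        + Polynomial.smult (of_nat (k + 1)) (bernstein_poly n (k + 1))"
  \<comment> \<open>For \<open>k = n\<close> the raising identity does not apply, but both sides are
    0.\<close>
  proof (cases "k = n")
    case False
    then show ?thesis using bernstein_raise_left[of k n] assms binom by simp
  qed (simp add: bernstein_poly_eq_0)
  have "pderiv (bernstein_poly n k :: 'a poly)
      = Polynomial.smult (of_nat k * of_nat (n choose k)) (?x ^ (k - 1) * ?y ^ (n - k))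
        - Polynomial.smult (of_nat (n - k) * of_nat (n choose k)) (?x ^ k * ?y ^ (n - k - 1))"
    unfolding bernstein_poly_def pderiv_smult pderiv_bernstein_monomial
    by (simp only: smult_diff_right smult_smult mult.commute)
  also have "\<dots> = (if k = 0 then 0 else Polynomial.smult (of_nat (n - (k - 1))) (bernstein_poly n (k - 1)))
      + Polynomial.smult (of_nat k - of_nat (n - k)) (bernstein_poly n k)
      - Polynomial.smult (of_nat (k + 1)) (bernstein_poly n (k + 1))"
    unfolding left right by (simp only: smult_diff_left) (simp add: algebra_simps)
  also have "of_nat k - of_nat (n - k) = (2 * of_nat k - of_nat n :: 'a)"
    using assms by (simp add: of_nat_diff)
  finally show ?thesis .
qed

definition bernstein_diff_mat :: "nat \<Rightarrow> 'a::field_char_0 mat" where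
  "bernstein_diff_mat n = mat (n + 1) (n + 1) (\<lambda>(i, j).
     if i = j then 2 * of_nat i - of_nat n
     else if i = j + 1 then - of_nat i
     else if j = i + 1 then of_nat n - of_nat i
     else 0)"

lemma bernstein_diff_mat_carrier: "bernstein_diff_mat n \<in> carrier_mat (n + 1) (n + 1)"
  by (simp add: bernstein_diff_mat_def)

lemma sum_column_bernstein_diff_mat:
  assumes "j \<le> n"
  shows "(\<Sum>i=0..n. Polynomial.smult (bernstein_diff_mat n $$ (i, j)) (bernstein_poly n i))
    = pderiv (bernstein_poly n j :: 'a::field_char_0 poly)"
proof -
  let ?B = "bernstein_poly n :: nat \<Rightarrow> 'a poly"
  \<comment> \<open>Each nonzero entry of column \<open>j\<close> becomes an indicator in
    \<open>i\<close>, so that \<open>sum.delta\<close> can evaluate the sum.\<close>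
  have "Polynomial.smult (bernstein_diff_mat n $$ (i, j)) (?B i)
      = (if i = j - 1 then if j = 0 then 0 else Polynomial.smult (of_nat (n - (j - 1))) (?B (j - 1)) else 0)
        + (if i = j then Polynomial.smult (2 * of_nat j - of_nat n) (?B j) else 0)
        - (if i = j + 1 then Polynomial.smult (of_nat (j + 1)) (?B (j + 1)) else 0)"
    if "i \<le> n" for i
    using that assms by (auto simp: bernstein_diff_mat_def of_nat_diff simp flip: smult_minus_left)
  then have "(\<Sum>i=0..n. Polynomial.smult (bernstein_diff_mat n $$ (i, j)) (?B i))
      = (\<Sum>i=0..n. (if i = j - 1 then if j = 0 then 0 else Polynomial.smult (of_nat (n - (j - 1))) (?B (j - 1)) else 0)
        + (if i = j then Polynomial.smult (2 * of_nat j - of_nat n) (?B j) else 0)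
        - (if i = j + 1 then Polynomial.smult (of_nat (j + 1)) (?B (j + 1)) else 0))"
    by (intro sum.cong) auto
  also have "\<dots> = pderiv (?B j)"
    \<comment> \<open>For \<open>j = n\<close> the index \<open>j + 1\<close> falls outside the sum,
      in agreement with the vanishing polynomial of index \<open>n + 1\<close>.\<close>
    unfolding pderiv_bernstein_poly[OF assms] sum.distrib sum_subtractf sum.delta[OF finite_atLeastAtMost]
    using assms by (auto simp: bernstein_poly_eq_0)
  finally show ?thesis .
qed

lemma pderiv_bernstein_comb:
  fixes a :: "'a::field_char_0 vec"
  assumes "a \<in> carrier_vec (n + 1)"
  shows "pderiv (bernstein_comb n a) = bernstein_comb n (bernstein_diff_mat n *\<^sub>v a)"
proof -
  let ?M = "bernstein_diff_mat n :: 'a mat" and ?B = "bernstein_poly n :: nat \<Rightarrow> 'a poly"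
  have entry: "(?M *\<^sub>v a) $ i = (\<Sum>j=0..n. ?M $$ (i, j) * a $ j)" if "i \<le> n" for i
    using that assms bernstein_diff_mat_carrier[of n, where 'a='a]
    by (auto simp: scalar_prod_def atLeastLessThanSuc_atLeastAtMost intro!: sum.cong)
  have "bernstein_comb n (?M *\<^sub>v a)
      = (\<Sum>i=0..n. \<Sum>j=0..n. Polynomial.smult (a $ j) (Polynomial.smult (?M $$ (i, j)) (?B i)))"
    unfolding bernstein_comb_def
    by (intro sum.cong) (simp_all add: entry smult_sum mult.commute)
  \<comment> \<open>Exchanging the sums collects the matrix by columns, each of which expands the
    derivative of one basis element.\<close>
  also have "\<dots> = (\<Sum>j=0..n. Polynomial.smult (a $ j) (\<Sum>i=0..n. Polynomial.smult (?M $$ (i, j)) (?B i)))"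
    by (subst sum.swap) (simp add: smult_sum_right)
  also have "\<dots> = (\<Sum>j=0..n. Polynomial.smult (a $ j) (pderiv (?B j)))"
    by (intro sum.cong) (simp_all add: sum_column_bernstein_diff_mat)
  also have "\<dots> = pderiv (bernstein_comb n a)"
    by (simp add: bernstein_comb_def pderiv_sum pderiv_smult)
  finally show ?thesis ..
qed

text \<open>The defining property is an implication, so the forward direction needs every derivative
  to have an expansion, and the backward direction needs expansions to be unique.\<close>

lemma is_bernstein_diff_mat_iff:
  "is_bernstein_diff_mat n D \<longleftrightarrow> D = bernstein_diff_mat n"
proof
  assume D: "is_bernstein_diff_mat n D"
  have carr: "D \<in> carrier_mat (n + 1) (n + 1)"
    using D by (simp add: is_bernstein_diff_mat_def)
  show "D = bernstein_diff_mat n"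
  proof (rule mat_col_eqI)
    fix j assume "j < dim_col (bernstein_diff_mat n :: 'a mat)"
    then have j: "j < n + 1" by (simp add: bernstein_diff_mat_def)
    \<comment> \<open>Instantiate \<open>a\<close> with the unit vector and \<open>b\<close> with
      its image under \<open>bernstein_diff_mat n\<close>, a valid expansion of the derivative; this
      fixes column \<open>j\<close> of \<open>D\<close>.\<close>
    have "bernstein_diff_mat n *\<^sub>v unit_vec (n + 1) j = D *\<^sub>v unit_vec (n + 1) j"
      using D pderiv_bernstein_comb[OF unit_vec_carrier]
        mult_mat_vec_carrier[OF bernstein_diff_mat_carrier unit_vec_carrier] unit_vec_carrier
      unfolding is_bernstein_diff_mat_def by blast
    then show "col D j = col (bernstein_diff_mat n) j"
      using j carr bernstein_diff_mat_carrier[of n, where 'a='a]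
      by (metis mult_mat_vec_unit_vec)
  qed (use carr in \<open>simp_all add: bernstein_diff_mat_def\<close>)
next
  assume "D = bernstein_diff_mat n"
  then show "is_bernstein_diff_mat n D"
    unfolding is_bernstein_diff_mat_def
    by (metis bernstein_comb_inject bernstein_diff_mat_carrier mult_mat_vec_carrier
        pderiv_bernstein_comb)
qed

theorem mainTheorem4:
  fixes n :: nat and D :: "'a::field_char_0 mat"
  assumes "n \<ge> 1"
  shows "is_bernstein_diff_mat n D \<longleftrightarrow>
    D \<in> carrier_mat (n + 1) (n + 1) \<and>
    (\<forall>i \<le> n. \<forall>j \<le> n. D $$ (i, j) =
       (if i = j then 2 * of_nat i - of_nat n
        else if i = j + 1 then - of_nat i
        else if j = i + 1 then of_nat n - of_nat i
        else 0))"
  unfolding is_bernstein_diff_mat_iff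
  by (auto simp: bernstein_diff_mat_def split del: if_split intro!: eq_matI)

end
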